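(* The set of positive integers $n$ such that $e(n) = e(n+1)$ equals $$\{2^{2k+1} n + p_k \mid k, n \in \mathbb{N}_+\} \cup \{2p_k \mid k \in \mathbb{N}_+\} \cup \{2^{2k+1} n + q_k \mid k, n \in \mathbb{N},\ k > 0\}.$$
   Context: $\mathbb{N}$ denotes the set of non-negative integers and $\mathbb{N}_+$ the set of positive integers. The Stern polynomials $B_n(t) \in \mathbb{Z}[t]$, $n \geq 0$, are defined by $B_0(t) = 0$, $B_1(t) = 1$, and for $n \geq 2$: $B_n(t) = t\,B_{n/2}(t)$ if $n$ is even, and $B_n(t) = B_{(n+1)/2}(t) + B_{(n-1)/2}(t)$ if $n$ is odd. For $n \geq 1$, $e(n) = \deg B_n(t)$. For $n \geq 0$, $p_n = \frac{4^n - 1}{3}$ and $q_n = \frac{5 \cdot 4^n - 2}{3}$. *)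

theory Defs
  imports "HOL-Computational_Algebra.Polynomial"
begin

function stern_poly :: "nat \<Rightarrow> int poly" where
  "stern_poly n =
    (if n = 0 then 0
     else if n = 1 then 1
     else if even n then [:0, 1:] * stern_poly (n div 2)
     else stern_poly ((n + 1) div 2) + stern_poly ((n - 1) div 2))"
  by auto
termination
  by (relation "measure id") (auto elim!: oddE)

declare stern_poly.simps [simp del]

definition stern_deg :: "nat \<Rightarrow> nat" where
  "stern_deg n = degree (stern_poly n)"

(* Subtraction and division on nat are exact in the next two definitions:
   see three_p_seq and three_q_seq. *)

definition p_seq :: "nat \<Rightarrow> nat" where
  "p_seq n = (4 ^ n - 1) div 3"

definition q_seq :: "nat \<Rightarrow> nat" where
  "q_seq n = (5 * 4 ^ n - 2) div 3"

lemma three_p_seq: "3 * p_seq n + 1 = 4 ^ n"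
proof -
  have "\<exists>m. (4::nat) ^ n = 3 * m + 1"
  proof (induction n)
    case (Suc n)
    then obtain m where "(4::nat) ^ n = 3 * m + 1" by blast
    then have "(4::nat) ^ Suc n = 3 * (4 * m + 1) + 1" by simp
    then show ?case by blast
  qed simp
  then show ?thesis by (auto simp: p_seq_def)
qed

lemma three_q_seq: "3 * q_seq n + 2 = 5 * 4 ^ n"
proof -
  have "5 * 4 ^ n = 3 * (5 * p_seq n + 1) + (2::nat)"
    by (simp flip: three_p_seq)
  then show ?thesis by (simp add: q_seq_def)
qed

end

theory Submission
  imports Defs
begin

text \<open>Everything happens in the difference \<open>d n = e (n + 1) - e n\<close>.  The coefficients of Stern
  polynomials are non-negative, so no cancellation occurs in a sum and the degree satisfies
  \<open>e (2 n) = e n + 1\<close> and \<open>e (2 n + 1) = max (e n) (e (n + 1))\<close> for \<open>n > 0\<close>.  Subtracting, \<open>d (2 n)\<close>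
  and \<open>d (2 n + 1)\<close> depend on \<open>d n\<close> alone: \<open>d\<close> is computed by an automaton that reads the binary
  digits of its argument from the leading one on, and its only states are \<open>-1\<close>, \<open>0\<close> and \<open>1\<close>.

  Reading two digits at a time, a positive zero of \<open>d\<close> has the form \<open>4 a + 1\<close> or \<open>4 a + 2\<close>.  Now \<open>d\<close> vanishes at
  \<open>4 a + 2\<close> iff \<open>d a \<ge> 0\<close> and at \<open>4 a + 1\<close> iff \<open>a > 0\<close> and \<open>d a \<le> 0\<close>.  As \<open>d\<close> is \<open>\<le> 0\<close> on even and
  \<open>\<ge> 0\<close> on odd numbers, the parity of \<open>a\<close> settles one half of these cases and gives the numbers
  \<open>8 l + 6\<close> and \<open>8 l + 1\<close> (\<open>l > 0\<close>); in the other half \<open>a\<close> is \<open>0\<close>, which gives the number \<open>2\<close>, or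
  a smaller zero of \<open>d\<close>.  So every zero arises from these seeds by iterating \<open>a \<mapsto> 4 a + 2\<close> on even
  and \<open>a \<mapsto> 4 a + 1\<close> on odd numbers.  Each step multiplies the coefficient
  of \<open>l\<close> by \<open>4\<close>; the constant term follows \<open>x \<mapsto> 4 x + 1\<close>, the recurrence of \<open>p\<close>, or \<open>x \<mapsto> 4 x + 2\<close>,
  that of both \<open>q\<close> and \<open>2 p\<close>.  So the orbits of \<open>8 l + 1\<close>, \<open>2\<close> and \<open>8 l + 6\<close> are the three
  families of the theorem, in this order.\<close>

lemma degree_add_nonneg_coeffs:
  fixes p q :: "'a :: linordered_idom poly"
  assumes p: "\<And>i. 0 \<le> coeff p i" and q: "\<And>i. 0 \<le> coeff q i"
  shows "degree (p + q) = max (degree p) (degree q)"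
proof (rule antisym)
  show "degree (p + q) \<le> max (degree p) (degree q)"
    by (rule degree_add_le_max)
  have le: "degree r \<le> degree (r + s)"
    if r: "\<And>i. 0 \<le> coeff r i" and s: "\<And>i. 0 \<le> coeff s i" for r s :: "'a poly"
  proof (cases "r = 0")
    case False
    then have "0 < coeff r (degree r)"
      using r[of "degree r"] by (simp add: less_le)
    then have "coeff (r + s) (degree r) \<noteq> 0"
      using s[of "degree r"] by (simp add: add_pos_nonneg less_imp_neq[symmetric])
    then show ?thesis by (rule le_degree)
  qed simp
  show "max (degree p) (degree q) \<le> degree (p + q)"
    using le[OF p q] le[OF q p] by (simp add: add.commute)
qed

lemma stern_poly_0: "stern_poly 0 = 0"
  by (simp add: stern_poly.simps)

lemma stern_poly_double: "stern_poly (2 * n) = [:0, 1:] * stern_poly n"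
  by (cases "n = 0") (simp_all add: stern_poly.simps[of "2 * n"] stern_poly_0)

lemma stern_poly_odd:
  assumes "n > 0"
  shows "stern_poly (2 * n + 1) = stern_poly (n + 1) + stern_poly n"
  using assms by (subst stern_poly.simps) simp

lemma coeff_stern_poly_nonneg: "0 \<le> coeff (stern_poly n) i"
proof (induction n arbitrary: i rule: stern_poly.induct)
  case (1 n)
  then show ?case
    by (subst stern_poly.simps) (auto simp: coeff_pCons split: nat.split)
qed

text \<open>Evaluation at \<open>1\<close> turns the recursion into that of Stern's diatomic sequence, which is
  positive; this is a quick way to see that the polynomials do not vanish.\<close>

lemma poly_stern_poly_1_pos: "n > 0 \<Longrightarrow> 0 < poly (stern_poly n) 1"
proof (induction n rule: stern_poly.induct)
  case (1 n)
  show ?case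
  proof (cases "n = 1 \<or> even n")
    case True
    then show ?thesis using 1 by (subst stern_poly.simps) auto
  next
    case False
    then have "0 < (n + 1) div 2" "0 < (n - 1) div 2"
      using 1 by (auto elim!: oddE)
    then show ?thesis
      using 1 False by (subst stern_poly.simps) auto
  qed
qed

lemma stern_deg_double: "n > 0 \<Longrightarrow> stern_deg (2 * n) = stern_deg n + 1"
  using poly_stern_poly_1_pos[of n]
  by (auto simp: stern_deg_def stern_poly_double)

text \<open>At \<open>n = 0\<close>, where the polynomial recursion for odd arguments would be circular, the identity
  rests on the convention that the zero polynomial has degree \<open>0\<close>.\<close>

lemma stern_deg_odd: "stern_deg (2 * n + 1) = max (stern_deg n) (stern_deg (n + 1))"
proof (cases "n = 0")
  case True
  then show ?thesis by (simp add: stern_deg_def stern_poly.simps)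
next
  case False
  then show ?thesis
    by (simp add: stern_deg_def stern_poly_odd[simplified] max.commute
        degree_add_nonneg_coeffs coeff_stern_poly_nonneg)
qed

section \<open>The difference of consecutive degrees\<close>

definition stern_deg_diff :: "nat \<Rightarrow> int" where
  "stern_deg_diff n = int (stern_deg (n + 1)) - int (stern_deg n)"

lemma stern_deg_diff_eq_0_iff: "stern_deg_diff n = 0 \<longleftrightarrow> stern_deg n = stern_deg (n + 1)"
  by (auto simp: stern_deg_diff_def)

lemma stern_deg_diff_0 [simp]: "stern_deg_diff 0 = 0"
  by (simp add: stern_deg_diff_def stern_deg_def stern_poly.simps)

lemma stern_deg_diff_double:
  "n > 0 \<Longrightarrow> stern_deg_diff (2 * n) = max 0 (stern_deg_diff n) - 1"
  using stern_deg_odd[of n] stern_deg_double[of n]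
  by (simp add: stern_deg_diff_def)

lemma stern_deg_diff_odd: "stern_deg_diff (2 * n + 1) = 1 + min 0 (stern_deg_diff n)"
  using stern_deg_odd[of n] stern_deg_double[of "n + 1"]
  by (simp add: stern_deg_diff_def)

lemma stern_deg_diff_bounds: "\<bar>stern_deg_diff n\<bar> \<le> 1"
proof (induction n rule: less_induct)
  case (less n)
  consider "n = 0" | m where "n = 2 * m" "m > 0" | m where "n = 2 * m + 1"
    by (metis evenE oddE gr0I mult_0_right)
  then show ?case
  proof cases
    case 2
    then show ?thesis using less[of m] by (simp add: stern_deg_diff_double)
  next
    case (3 m)
    then show ?thesis using less[of m] stern_deg_diff_odd[of m] by simp
  qed simp
qed

lemma stern_deg_diff_double_le_0: "stern_deg_diff (2 * n) \<le> 0"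
  using stern_deg_diff_bounds[of n] by (cases "n = 0") (auto simp: stern_deg_diff_double)

lemma stern_deg_diff_odd_ge_0: "0 \<le> stern_deg_diff (2 * n + 1)"
  using stern_deg_diff_bounds[of n] stern_deg_diff_odd[of n] by auto

section \<open>Two binary digits at a time\<close>

lemma stern_deg_diff_4_0: "n > 0 \<Longrightarrow> stern_deg_diff (4 * n) \<noteq> 0"
  using stern_deg_diff_double[of "2 * n"] stern_deg_diff_double_le_0[of n] by simp

lemma stern_deg_diff_4_1_eq_0_iff:
  "stern_deg_diff (4 * n + 1) = 0 \<longleftrightarrow> n > 0 \<and> stern_deg_diff n \<le> 0"
proof (cases "n = 0")
  case True
  then show ?thesis using stern_deg_diff_odd[of 0] by simp
next
  case False
  then show ?thesis
    using stern_deg_diff_odd[of "2 * n"] stern_deg_diff_double[of n] by auto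
qed

lemma stern_deg_diff_4_2_eq_0_iff:
  "stern_deg_diff (4 * n + 2) = 0 \<longleftrightarrow> 0 \<le> stern_deg_diff n"
  using stern_deg_diff_double[of "2 * n + 1"] stern_deg_diff_odd[of n] by auto

lemma stern_deg_diff_4_3: "stern_deg_diff (4 * n + 3) \<noteq> 0"
  using stern_deg_diff_odd[of "2 * n + 1"] stern_deg_diff_odd_ge_0[of n]
  by (simp add: numeral_3_eq_3)

section \<open>The three families\<close>

lemma p_seq_1: "p_seq (Suc 0) = 1"
  by (simp add: p_seq_def)

lemma p_seq_Suc: "p_seq (Suc k) = 4 * p_seq k + 1"
  using three_p_seq[of k] three_p_seq[of "Suc k"] by simp

lemma q_seq_1: "q_seq (Suc 0) = 6"
  by (simp add: q_seq_def)

lemma q_seq_Suc: "q_seq (Suc k) = 4 * q_seq k + 2"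
  using three_q_seq[of k] three_q_seq[of "Suc k"] by simp

lemma odd_p_seq: "k > 0 \<Longrightarrow> odd (p_seq k)"
  by (cases k) (auto simp: p_seq_Suc)

lemma even_q_seq: "k > 0 \<Longrightarrow> even (q_seq k)"
  by (cases k) (auto simp: q_seq_Suc)

lemma stern_deg_diff_p_family:
  assumes "n > 0"
  shows "stern_deg_diff (2 ^ (2 * Suc j + 1) * n + p_seq (Suc j)) = 0"
proof (induction j)
  case 0
  show ?case
    using assms stern_deg_diff_4_1_eq_0_iff[of "2 * n"] stern_deg_diff_double_le_0[of n]
    by (simp add: p_seq_1)
next
  case (Suc j)
  have "2 ^ (2 * Suc (Suc j) + 1) * n + p_seq (Suc (Suc j)) =
      4 * (2 ^ (2 * Suc j + 1) * n + p_seq (Suc j)) + 1"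
    by (simp add: p_seq_Suc[of "Suc j"])
  moreover have "0 < 2 ^ (2 * Suc j + 1) * n + p_seq (Suc j)"
    using assms by simp
  ultimately show ?case
    using Suc by (simp only: stern_deg_diff_4_1_eq_0_iff order_refl simp_thms)
qed

lemma stern_deg_diff_2p_family: "stern_deg_diff (2 * p_seq (Suc j)) = 0"
proof (induction j)
  case 0
  show ?case
    using stern_deg_diff_4_2_eq_0_iff[of 0] by (simp add: p_seq_1 numeral_2_eq_2)
next
  case (Suc j)
  have "2 * p_seq (Suc (Suc j)) = 4 * (2 * p_seq (Suc j)) + 2"
    by (simp add: p_seq_Suc[of "Suc j"])
  then show ?case
    using Suc stern_deg_diff_4_2_eq_0_iff[of "2 * p_seq (Suc j)"] by simp
qed

lemma stern_deg_diff_q_family: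
  "stern_deg_diff (2 ^ (2 * Suc j + 1) * n + q_seq (Suc j)) = 0"
proof (induction j)
  case 0
  have "2 ^ (2 * Suc 0 + 1) * n + q_seq (Suc 0) = 4 * (2 * n + 1) + 2"
    by (simp add: q_seq_1)
  then show ?case
    using stern_deg_diff_odd_ge_0[of n] by (simp only: stern_deg_diff_4_2_eq_0_iff)
next
  case (Suc j)
  have "2 ^ (2 * Suc (Suc j) + 1) * n + q_seq (Suc (Suc j)) =
      4 * (2 ^ (2 * Suc j + 1) * n + q_seq (Suc j)) + 2"
    by (simp add: q_seq_Suc[of "Suc j"])
  then show ?case
    using Suc by (simp only: stern_deg_diff_4_2_eq_0_iff order_refl)
qed

text \<open>That every zero lies in one of the families follows by the descent \<open>n \<mapsto> n div 4\<close>, until one of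
  the seeds \<open>8 l + 1\<close>, \<open>2\<close>, \<open>8 l + 6\<close> is reached.  The descent stays within one family: \<open>4 a + 2\<close> leads to an
  even \<open>a\<close>, which excludes the first family, and \<open>4 a + 1\<close> to an odd \<open>a\<close>, which excludes the other
  two.\<close>

lemma stern_deg_diff_eq_0_cases:
  assumes "n > 0" "stern_deg_diff n = 0"
  shows "(\<exists>k m. k > 0 \<and> m > 0 \<and> n = 2 ^ (2 * k + 1) * m + p_seq k) \<or>
    (\<exists>k>0. n = 2 * p_seq k) \<or>
    (\<exists>k m. k > 0 \<and> n = 2 ^ (2 * k + 1) * m + q_seq k)"
    (is "?P n \<or> ?D n \<or> ?Q n")
  using assms
proof (induction n rule: less_induct)
  case (less n)
  define a where "a = n div 4"
  have "n = 4 * a \<or> n = 4 * a + 1 \<or> n = 4 * a + 2 \<or> n = 4 * a + 3"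
    unfolding a_def by presburger
  then consider (one) "n = 4 * a + 1" | (two) "n = 4 * a + 2"
    using less.prems stern_deg_diff_4_0[of a] stern_deg_diff_4_3[of a] by auto
  then show ?case
  proof cases
    case one
    then have a: "a > 0" "stern_deg_diff a \<le> 0"
      using less.prems stern_deg_diff_4_1_eq_0_iff[of a] by auto
    show ?thesis
    proof (cases "even a")
      case True
      then obtain l where "a = 2 * l" by (rule evenE)
      then have "l > 0" "n = 2 ^ (2 * 1 + 1) * l + p_seq 1"
        using a one by (simp_all add: p_seq_1)
      then show ?thesis using zero_less_one by blast
    next
      case False
      then have "stern_deg_diff a = 0"
        using a stern_deg_diff_odd_ge_0 by (metis oddE antisym)
      then have "?P a \<or> ?D a \<or> ?Q a"
        using less.IH[of a] a one by simp
      moreover have "\<not> ?D a" "\<not> ?Q a"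
        using False even_q_seq by auto
      ultimately obtain k m where "k > 0" "m > 0" "a = 2 ^ (2 * k + 1) * m + p_seq k"
        by blast
      then have "n = 2 ^ (2 * Suc k + 1) * m + p_seq (Suc k)"
        using one by (simp add: p_seq_Suc)
      then show ?thesis using \<open>m > 0\<close> zero_less_Suc by blast
    qed
  next
    case two
    then have a: "0 \<le> stern_deg_diff a"
      using less.prems stern_deg_diff_4_2_eq_0_iff[of a] by auto
    consider (zero) "a = 0" | (odd) "odd a" | (even) "a > 0" "even a" by blast
    then show ?thesis
    proof cases
      case zero
      then have "n = 2 * p_seq 1" using two by (simp add: p_seq_1)
      then show ?thesis using zero_less_one by blast
    next
      case odd
      then obtain l where "a = 2 * l + 1" by (rule oddE)
      then have "n = 2 ^ (2 * 1 + 1) * l + q_seq 1"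
        using two by (simp add: q_seq_1)
      then show ?thesis using zero_less_one by blast
    next
      case even
      then have "stern_deg_diff a = 0"
        using a stern_deg_diff_double_le_0 by (metis evenE antisym)
      then have "?P a \<or> ?D a \<or> ?Q a"
        using less.IH[of a] even two by simp
      moreover have "\<not> ?P a"
        using even odd_p_seq by auto
      ultimately consider (D) k where "k > 0" "a = 2 * p_seq k"
        | (Q) k m where "k > 0" "a = 2 ^ (2 * k + 1) * m + q_seq k"
        by blast
      then show ?thesis
      proof cases
        case (D k)
        then have "n = 2 * p_seq (Suc k)" using two by (simp add: p_seq_Suc)
        then show ?thesis using zero_less_Suc by blast
      next
        case (Q k m)
        then have "n = 2 ^ (2 * Suc k + 1) * m + q_seq (Suc k)"
          using two by (simp add: q_seq_Suc)
        then show ?thesis using zero_less_Suc by blast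
      qed
    qed
  qed
qed

theorem theorem3p1:
  shows "{n :: nat. n > 0 \<and> stern_deg n = stern_deg (n + 1)} =
    {2 ^ (2 * k + 1) * n + p_seq k | k n :: nat. k > 0 \<and> n > 0} \<union>
    {2 * p_seq k | k :: nat. k > 0} \<union>
    {2 ^ (2 * k + 1) * n + q_seq k | k n :: nat. k > 0}"
    (is "?Z = ?P \<union> ?D \<union> ?Q")
proof (rule set_eqI)
  fix x
  have Z: "x \<in> ?Z \<longleftrightarrow> x > 0 \<and> stern_deg_diff x = 0"
    by (simp add: stern_deg_diff_eq_0_iff)
  show "x \<in> ?Z \<longleftrightarrow> x \<in> ?P \<union> ?D \<union> ?Q"
  proof
    assume "x \<in> ?Z"
    then show "x \<in> ?P \<union> ?D \<union> ?Q"
      using stern_deg_diff_eq_0_cases[of x] unfolding Z by blast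
  next
    assume "x \<in> ?P \<union> ?D \<union> ?Q"
    then consider (P) k n where "k > 0" "n > 0" "x = 2 ^ (2 * k + 1) * n + p_seq k"
      | (D) k where "k > 0" "x = 2 * p_seq k"
      | (Q) k n where "k > 0" "x = 2 ^ (2 * k + 1) * n + q_seq k"
      by blast
    then show "x \<in> ?Z"
      unfolding Z
    proof cases
      case (P k n)
      then show "x > 0 \<and> stern_deg_diff x = 0"
        using stern_deg_diff_p_family[of n "k - 1"] by simp
    next
      case (D k)
      then show "x > 0 \<and> stern_deg_diff x = 0"
        using stern_deg_diff_2p_family[of "k - 1"] odd_p_seq[of k] by (auto intro: odd_pos)
    next
      case (Q k n)
      then show "x > 0 \<and> stern_deg_diff x = 0"
        using stern_deg_diff_q_family[of "k - 1" n] three_q_seq[of k]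
          q_seq_Suc[of "k - 1"] by simp
    qed
  qed
qed

end
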